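(* Let $\mathbf k$ be a field of characteristic $0$, $\mathcal N$ a nonempty set and $\varphi:\mathcal N\to\mathbf k$ a function, extended to words by $\varphi(n_1\cdots n_r)=\varphi(n_1)+\cdots+\varphi(n_r)$. Let $\mathbf K=\mathbf k((\varepsilon))$ and let $T\in\mathbf K^{\underline{\mathcal N}}$ be the mould $$T^{n_1\cdots n_r}(\varepsilon)=\frac1{(\varphi(n_1)+\varepsilon)(\varphi(n_1n_2)+2\varepsilon)\cdots(\varphi(n_1\cdots n_r)+r\varepsilon)},\qquad T^\varnothing=1,$$ and let $(U_-,U_+)$ be its Birkhoff decomposition. Define moulds $R,S\in\mathbf k^{\underline{\mathcal N}}$ by $$R^{\underline n}=-r(\underline n)\,\big(\text{residue of }U_-^{\underline n}(\varepsilon)\big),\qquad S^{\underline n}=\text{constant term of }U_+^{\underline n}(\varepsilon).$$ Then $(R,S)$ solves the mould equation $$\nabla_\varphi S=S\times I_{\mathbf k}-R\times S,\qquad \nabla_\varphi R=0,\qquad S\ \text{symmetral}.$$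
   Context: $\underline{\mathcal N}$ is the set of words (finite sequences) on the alphabet $\mathcal N$, including the empty word $\varnothing$; $r(\underline n)$ is the length of $\underline n$. For a commutative ring $A$, an $A$-valued mould is a function $M:\underline{\mathcal N}\to A$, $\underline n\mapsto M^{\underline n}$; the set $A^{\underline{\mathcal N}}$ of moulds is an associative algebra for $(M\times M')^{\underline n}=\sum_{\underline a\,\underline b=\underline n}M^{\underline a}M'^{\underline b}$ (sum over all factorizations by concatenation, empty factors allowed), with unit $\mathbf 1$: $\mathbf 1^\varnothing=1$, $\mathbf 1^{\underline n}=0$ for $\underline n\ne\varnothing$. $I_{\mathbf k}$ is the mould with $I_{\mathbf k}^{\underline n}=1$ if $r(\underline n)=1$ and $0$ otherwise. $\nabla_\varphi$ is the operator $(\nabla_\varphi M)^{\underline n}=\varphi(\underline n)M^{\underline n}$ (with $\varphi(\varnothing)=0$). For words $\underline a,\underline b,\underline n$, the shuffling coefficient $\mathrm{sh}(\underline a,\underline b;\underline n)$ is the number of ways $\underline n$ can be obtained by interdigitating the letters of $\underline a$ and $\underline b$ while preserving their internal order in $\underline a$ and $\underline b$. A mould $M$ is symmetral if $M^\varnothing=1$ and $\sum_{\underline n}\mathrm{sh}(\underline a,\underline b;\underline n)M^{\underline n}=M^{\underline a}M^{\underline b}$ for all nonempty words $\underline a,\underline b$. Birkhoff decomposition: $\mathbf K=\mathbf K_+\oplus\mathbf K_-$ with $\mathbf K_+=\mathbf k[[\varepsilon]]$, $\mathbf K_-=\varepsilon^{-1}\mathbf k[\varepsilon^{-1}]$. The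 Birkhoff decomposition of $T$ is the unique pair $(U_-,U_+)$ of $\mathbf K$-valued moulds with $U_\pm^\varnothing=1$, $U_-^{\underline n}\in\mathbf K_-$ and $U_+^{\underline n}\in\mathbf K_+$ for all nonempty $\underline n$, and $U_-\times T=U_+$. The constant term and residue of $\sum_n c_n\varepsilon^n$ are $c_0$ and $c_{-1}$. *)

theory Defs
  imports "HOL-Computational_Algebra.Computational_Algebra"
begin

notation fls_nth (infixl "$$" 75)

section \<open>Moulds\<close>

text \<open>
  Words over the alphabet \<open>'n\<close> (nonempty, like every type) are lists; an
  \<open>'a\<close>-valued mould is an arbitrary function on words.
\<close>

type_synonym ('n, 'a) mould = "'n list \<Rightarrow> 'a"

definition mould_mult ::
    "('n, 'a::comm_ring_1) mould \<Rightarrow> ('n, 'a) mould \<Rightarrow> ('n, 'a) mould" (infixl "\<otimes>\<^sub>m" 70) where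
  "(M \<otimes>\<^sub>m M') w = (\<Sum>(a, b) \<in> {(a, b). a @ b = w}. M a * M' b)"

definition mould_I :: "('n, 'a::comm_ring_1) mould" where
  "mould_I w = (if length w = 1 then 1 else 0)"

definition word_sum :: "('n \<Rightarrow> 'a::comm_ring_1) \<Rightarrow> 'n list \<Rightarrow> 'a" where
  "word_sum \<phi> w = sum_list (map \<phi> w)"

definition nabla ::
    "('n \<Rightarrow> 'a::comm_ring_1) \<Rightarrow> ('n, 'a) mould \<Rightarrow> ('n, 'a) mould" where
  "nabla \<phi> M w = word_sum \<phi> w * M w"


section \<open>Symmetral moulds\<close>

text \<open>
  A way of interdigitating \<open>a\<close> and \<open>b\<close> into \<open>w\<close> is determined by the set \<open>P\<close> of
  positions of \<open>w\<close> that are occupied by the letters of \<open>a\<close>. The library's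
  \<^const>\<open>shuffles\<close> is only a set, hence forgets the multiplicities.
\<close>

definition sh :: "'n list \<Rightarrow> 'n list \<Rightarrow> 'n list \<Rightarrow> nat" where
  "sh a b w = card {P. P \<subseteq> {..<length w} \<and> nths w P = a \<and> nths w ({..<length w} - P) = b}"

text \<open>
  The alphabet may be infinite, so the sum over all words is taken over the words with
  nonzero coefficient, which are finitely many by \<open>finite_sh_support\<close> below.
\<close>

definition symmetral :: "('n, 'a::comm_ring_1) mould \<Rightarrow> bool" where
  "symmetral M \<longleftrightarrow> M [] = 1 \<and>
     (\<forall>a b. a \<noteq> [] \<longrightarrow> b \<noteq> [] \<longrightarrow>
        (\<Sum>w \<in> {w. sh a b w \<noteq> 0}. of_nat (sh a b w) * M w) = M a * M b)"

lemma finite_sh_support: "finite {w. sh a b w \<noteq> 0}"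
proof (rule finite_subset)
  show "finite {w. set w \<subseteq> set a \<union> set b \<and> length w = length a + length b}"
    by (rule finite_lists_length_eq) simp
  show "{w. sh a b w \<noteq> 0} \<subseteq> {w. set w \<subseteq> set a \<union> set b \<and> length w = length a + length b}"
  proof (intro subsetI, elim CollectE, intro CollectI)
    fix w assume "sh a b w \<noteq> 0"
    then have "{P. P \<subseteq> {..<length w} \<and> nths w P = a \<and> nths w ({..<length w} - P) = b} \<noteq> {}"
      unfolding sh_def by (metis card.empty)
    then obtain P where P: "P \<subseteq> {..<length w}" "nths w P = a" "nths w ({..<length w} - P) = b"
      by auto
    have "{i. i < length w \<and> i \<in> P} = P" using P(1) by auto
    then have la: "length a = card P" using P(2) length_nths[of w P] by simp
    have "{i. i < length w \<and> i \<in> {..<length w} - P} = {..<length w} - P" by auto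
    then have lb: "length b = card ({..<length w} - P)"
      using P(3) length_nths[of w "{..<length w} - P"] by simp
    have fP: "finite P" using P(1) finite_subset by blast
    have "card P \<le> length w" using card_mono[OF _ P(1)] by simp
    then have "length w = length a + length b"
      using la lb card_Diff_subset[OF fP P(1)] by simp
    moreover have "set w \<subseteq> set a \<union> set b"
    proof
      fix x assume "x \<in> set w"
      then obtain i where i: "i < length w" "x = w ! i" by (auto simp: in_set_conv_nth)
      show "x \<in> set a \<union> set b"
      proof (cases "i \<in> P")
        case True
        then have "x \<in> set (nths w P)" using i by (auto simp: set_nths)
        then show ?thesis using P(2) by simp
      next
        case False
        then have "x \<in> set (nths w ({..<length w} - P))" using i by (auto simp: set_nths)
        then show ?thesis using P(3) by simp
      qed
    qed
    ultimately show "set w \<subseteq> set a \<union> set b \<and> length w = length a + length b" by simp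
  qed
qed


section \<open>Birkhoff decomposition\<close>

definition K_plus :: "'k::field fls set" where
  "K_plus = range fps_to_fls"

definition K_minus :: "'k::field fls set" where
  "K_minus = range (\<lambda>p. fls_X_inv * poly (map_poly fls_const p) fls_X_inv)"

definition is_birkhoff ::
    "('n, 'k::field fls) mould \<Rightarrow> ('n, 'k fls) mould \<times> ('n, 'k fls) mould \<Rightarrow> bool" where
  "is_birkhoff T = (\<lambda>(Um, Up). Um [] = 1 \<and> Up [] = 1 \<and>
     (\<forall>w. w \<noteq> [] \<longrightarrow> Um w \<in> K_minus \<and> Up w \<in> K_plus) \<and> Um \<otimes>\<^sub>m T = Up)"

text \<open>
  Meaningful when \<open>T [] = 1\<close>, in which case the pair exists and is unique: see
  \<open>ex1_birkhoff\<close> below.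
\<close>

definition birkhoff ::
    "('n, 'k::field fls) mould \<Rightarrow> ('n, 'k fls) mould \<times> ('n, 'k fls) mould" where
  "birkhoff T = (THE U. is_birkhoff T U)"

lemma K_plus_iff: "f \<in> K_plus \<longleftrightarrow> (\<forall>i<0. f $$ i = 0)"
proof
  assume "\<forall>i<0. f $$ i = 0"
  then have "f = fps_to_fls (fls_regpart f)"
    by (intro fls_eqI) simp
  then show "f \<in> K_plus" unfolding K_plus_def by blast
qed (auto simp: K_plus_def)

lemma poly_fls_X_inv_nth:
  "(fls_X_inv * poly (map_poly fls_const p) fls_X_inv) $$ i =
     (if i < 0 then coeff p (nat (- i - 1)) else (0::'k::field))"
proof (induction p arbitrary: i)
  case (pCons a p)
  have *: "map_poly fls_const (pCons a p) = pCons (fls_const a) (map_poly fls_const p)"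
    by (rule map_poly_pCons) (simp_all add: pCons.hyps)
  have "(fls_X_inv * poly (map_poly fls_const (pCons a p)) fls_X_inv) $$ i
        = fls_const a $$ (i + 1) +
          (fls_X_inv * poly (map_poly fls_const p) fls_X_inv) $$ (i + 1)"
    unfolding * by (subst fls_X_inv_times_conv_shift) simp
  also have "\<dots> = (if i < 0 then coeff (pCons a p) (nat (- i - 1)) else 0)"
  proof (cases "i < -1")
    case True
    then have "nat (- i - 1) = Suc (nat (- (i + 1) - 1))" by simp
    then show ?thesis using True by (simp only: pCons.IH) simp
  qed (auto simp only: pCons.IH, auto)
  finally show ?case .
qed simp

lemma K_minus_iff: "f \<in> K_minus \<longleftrightarrow> (\<forall>i\<ge>0. f $$ i = 0)"
proof
  assume *: "\<forall>i\<ge>0. f $$ i = 0"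
  have "f = fls_X_inv * poly (map_poly fls_const (poly_shift 1 (fls_prpart f))) fls_X_inv"
    using * by (intro fls_eqI) (simp add: poly_fls_X_inv_nth coeff_poly_shift)
  then show "f \<in> K_minus" unfolding K_minus_def by blast
qed (auto simp: K_minus_def poly_fls_X_inv_nth)

lemma mould_mult_take_drop:
  "(M \<otimes>\<^sub>m M') w = (\<Sum>i\<le>length w. M (take i w) * M' (drop i w))"
  unfolding mould_mult_def
  by (rule sum.reindex_bij_witness
      [of _ "\<lambda>i. (take i w, drop i w)" "\<lambda>(a, b). length a"]) auto

lemma mould_mult_Nil: "(M \<otimes>\<^sub>m M') [] = M [] * M' []"
  by (simp add: mould_mult_take_drop)

lemma mould_mult_nonempty:
  assumes "w \<noteq> []"
  shows "(M \<otimes>\<^sub>m M') w =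
    M [] * M' w + (\<Sum>i\<in>{1..<length w}. M (take i w) * M' (drop i w)) + M w * M' []"
proof -
  have "{..length w} = insert 0 (insert (length w) {1..<length w})"
    using assms by (auto simp: Suc_le_eq)
  then show ?thesis using assms by (simp add: mould_mult_take_drop algebra_simps)
qed

function birkhoff_minus :: "('n, 'k::field fls) mould \<Rightarrow> ('n, 'k fls) mould" where
  "birkhoff_minus T w = (if w = [] then 1 else
     - fls_prpart_as_fls
         (T w + (\<Sum>i\<in>{1..<length w}. birkhoff_minus T (take i w) * T (drop i w))))"
  by pat_completeness auto
termination by (relation "measure (\<lambda>(T, w). length w)") auto

declare birkhoff_minus.simps [simp del]

lemma ex1_birkhoff:
  fixes T :: "('n, 'k::field fls) mould"
  assumes T: "T [] = 1"
  shows "\<exists>!U. is_birkhoff T U"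
proof (rule ex_ex1I)
  let ?Um = "birkhoff_minus T"
  have "?Um w \<in> K_minus \<and> (?Um \<otimes>\<^sub>m T) w \<in> K_plus" if "w \<noteq> []" for w
  proof -
    define x where "x = T w + (\<Sum>i\<in>{1..<length w}. ?Um (take i w) * T (drop i w))"
    have "?Um [] = 1" by (subst birkhoff_minus.simps) simp
    moreover have m: "?Um w = - fls_prpart_as_fls x"
      using that unfolding x_def by (subst birkhoff_minus.simps) simp
    ultimately have "(?Um \<otimes>\<^sub>m T) w = x - fls_prpart_as_fls x"
      using that T by (simp add: mould_mult_nonempty x_def)
    with m show ?thesis
      by (simp add: K_minus_iff K_plus_iff fls_prpart_as_fls_nth
               del: fls_shift_nth fps_to_fls_nth)
  qed
  moreover have "?Um [] = 1" by (subst birkhoff_minus.simps) simp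
  ultimately have "is_birkhoff T (?Um, ?Um \<otimes>\<^sub>m T)"
    using T by (simp add: is_birkhoff_def mould_mult_Nil)
  then show "\<exists>U. is_birkhoff T U" by blast
next
  fix U V assume "is_birkhoff T U" "is_birkhoff T V"
  then obtain Um Up Vm Vp where UV: "U = (Um, Up)" "V = (Vm, Vp)"
    and U: "Um [] = 1" "Um \<otimes>\<^sub>m T = Up" and V: "Vm [] = 1" "Vm \<otimes>\<^sub>m T = Vp"
    and Um: "\<And>w i. w \<noteq> [] \<Longrightarrow> i \<ge> 0 \<Longrightarrow> Um w $$ i = 0"
    and Vm: "\<And>w i. w \<noteq> [] \<Longrightarrow> i \<ge> 0 \<Longrightarrow> Vm w $$ i = 0"
    and Up: "\<And>w i. w \<noteq> [] \<Longrightarrow> i < 0 \<Longrightarrow> Up w $$ i = 0"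
    and Vp: "\<And>w i. w \<noteq> [] \<Longrightarrow> i < 0 \<Longrightarrow> Vp w $$ i = 0"
    by (cases U; cases V) (auto simp: is_birkhoff_def K_plus_iff K_minus_iff)
  have "Um w = Vm w" for w
  proof (induction w rule: length_induct)
    case (1 w)
    show ?case
    proof (cases "w = []")
      case False
      have "(\<Sum>i\<in>{1..<length w}. Um (take i w) * T (drop i w))
          = (\<Sum>i\<in>{1..<length w}. Vm (take i w) * T (drop i w))"
        using 1 by (intro sum.cong) auto
      then have d: "Um w - Vm w = Up w - Vp w"
        using False T U V by (auto simp: mould_mult_nonempty simp flip: U(2) V(2))
      have "(Um w - Vm w) $$ i = 0" for i
      proof (cases "i < 0")
        case True
        then show ?thesis unfolding d using False Up Vp by simp
      qed (use False Um Vm in simp)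
      then have "Um w - Vm w = 0" by (intro fls_eqI) simp
      then show ?thesis by simp
    qed (simp add: U V)
  qed
  then have "Um = Vm" by blast
  then show "U = V" using UV U V by simp
qed

lemma birkhoff_eq_iff:
  assumes "T [] = 1"
  shows "birkhoff T = U \<longleftrightarrow> is_birkhoff T U"
proof -
  have ex1: "\<exists>!U. is_birkhoff T U" using assms by (rule ex1_birkhoff)
  show ?thesis unfolding birkhoff_def
    using theI'[OF ex1] the1_equality[OF ex1] by blast
qed


section \<open>The mould to be decomposed\<close>

text \<open>The formal variable \<^const>\<open>fls_X\<close> plays the role of \<open>\<epsilon>\<close>.\<close>

definition T_mould :: "('n \<Rightarrow> 'k::field) \<Rightarrow> ('n, 'k fls) mould" where
  "T_mould \<phi> w =
     1 / (\<Prod>i = 1..length w. fls_const (word_sum \<phi> (take i w)) + of_nat i * fls_X)"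

lemma T_mould_Nil: "T_mould \<phi> [] = 1"
  by (simp add: T_mould_def)

end

theory Submission
  imports Defs
begin

text \<open>
  Replacing \<open>\<phi>\<close> by \<open>\<psi> = \<phi> + \<epsilon>\<close> makes \<open>T\<close> a solution of
  \<open>nabla \<psi> T = T \<times> I\<close>, and \<open>nabla \<psi>\<close> is a derivation. With \<open>V = nabla \<psi> U_minus + R \<times> U_minus\<close>
  one gets \<open>V \<times> T = nabla \<psi> U_plus - U_plus \<times> I + R \<times> U_plus\<close>, where \<open>R\<close> is chosen so that \<open>V\<close>
  has values in \<open>K_minus\<close>. The right-hand side has values in \<open>K_plus\<close>, so both sides vanish.
  The constant term of the right-hand side is the equation for \<open>S\<close>, and \<open>V = 0\<close> forces
  \<open>U_minus w = 0\<close> whenever \<open>\<phi> w \<noteq> 0\<close>, hence \<open>nabla \<phi> R = 0\<close>. Symmetrality passes from \<open>T\<close> to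
  \<open>U_plus\<close> because the shuffle coproduct is multiplicative and Birkhoff decompositions are unique.
\<close>

section \<open>The algebra of moulds\<close>

text \<open>The cut with empty prefix is split off; every other cut moves the first letter into the
  left mould. Inductions on words through this rule therefore generalize the left factor.\<close>

lemma mould_mult_Cons:
  "(M \<otimes>\<^sub>m N) (x # w) = M [] * N (x # w) + ((\<lambda>u. M (x # u)) \<otimes>\<^sub>m N) w"
  by (simp add: mould_mult_take_drop sum.atMost_Suc_shift del: sum.atMost_Suc)

lemma mould_mult_add_left:
  "((\<lambda>u. M u + M' u) \<otimes>\<^sub>m N) w = (M \<otimes>\<^sub>m N) w + (M' \<otimes>\<^sub>m N) w"
  by (simp add: mould_mult_take_drop distrib_right sum.distrib)

lemma mould_mult_scale_left:
  "((\<lambda>u. c * M u) \<otimes>\<^sub>m N) w = c * (M \<otimes>\<^sub>m N) w"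
  by (simp add: mould_mult_take_drop sum_distrib_left mult.assoc)

lemma mould_mult_assoc: "(A \<otimes>\<^sub>m B) \<otimes>\<^sub>m C = A \<otimes>\<^sub>m (B \<otimes>\<^sub>m C)"
proof
  show "((A \<otimes>\<^sub>m B) \<otimes>\<^sub>m C) w = (A \<otimes>\<^sub>m (B \<otimes>\<^sub>m C)) w" for w
  proof (induction w arbitrary: A)
    case Nil
    then show ?case by (simp add: mould_mult_Nil mult.assoc)
  next
    case (Cons x w)
    then show ?case
      by (simp add: mould_mult_Cons mould_mult_Nil mould_mult_add_left mould_mult_scale_left
          algebra_simps)
  qed
qed

lemma mould_mult_I: "(M \<otimes>\<^sub>m mould_I) w = (if w = [] then 0 else M (butlast w))"
proof (cases w rule: rev_cases)
  case (snoc u x)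
  have "(M \<otimes>\<^sub>m mould_I) w = (\<Sum>i\<le>length w. if i = length u then M u else 0)"
    unfolding mould_mult_take_drop using snoc
    by (intro sum.cong) (auto simp: mould_I_def)
  then show ?thesis using snoc by simp
qed (simp add: mould_mult_Nil mould_I_def)

lemma word_sum_append: "word_sum \<phi> (u @ v) = word_sum \<phi> u + word_sum \<phi> v"
  by (simp add: word_sum_def)

text \<open>Leibniz rule, from additivity of \<open>word_sum\<close> under concatenation.\<close>

lemma nabla_mould_mult:
  "nabla \<phi> (M \<otimes>\<^sub>m N) w = (nabla \<phi> M \<otimes>\<^sub>m N) w + (M \<otimes>\<^sub>m nabla \<phi> N) w"
proof -
  have w: "word_sum \<phi> w = word_sum \<phi> (take i w) + word_sum \<phi> (drop i w)" for i
    by (simp flip: word_sum_append)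
  show ?thesis
    unfolding nabla_def mould_mult_take_drop sum_distrib_left sum.distrib [symmetric]
  proof (intro sum.cong refl)
    fix i
    show "word_sum \<phi> w * (M (take i w) * N (drop i w)) =
        word_sum \<phi> (take i w) * M (take i w) * N (drop i w) +
        M (take i w) * (word_sum \<phi> (drop i w) * N (drop i w))"
      by (subst w [of i]) (simp add: algebra_simps)
  qed
qed


section \<open>The shuffle coproduct\<close>

text \<open>A multiset, so that words reached in several ways keep their multiplicity, as in
  \<open>sh\<close>; the recursion on first letters matches \<open>mould_mult_Cons\<close>.\<close>

fun shuf :: "'n list \<Rightarrow> 'n list \<Rightarrow> 'n list multiset" where
  "shuf [] b = {#b#}"
| "shuf (x # a) [] = {#x # a#}"
| "shuf (x # a) (y # b) =
     image_mset (Cons x) (shuf a (y # b)) + image_mset (Cons y) (shuf (x # a) b)"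

lemma shuf_Nil_right [simp]: "shuf a [] = {#a#}"
  by (cases a) simp_all

definition shuf_sum :: "('n, 'a::comm_ring_1) mould \<Rightarrow> 'n list \<Rightarrow> 'n list \<Rightarrow> 'a" where
  "shuf_sum M a b = (\<Sum>w\<in>#shuf a b. M w)"

lemma shuf_sum_simps [simp]:
  "shuf_sum M [] b = M b"
  "shuf_sum M a [] = M a"
  "shuf_sum M (x # a) (y # b) =
     shuf_sum (\<lambda>w. M (x # w)) a (y # b) + shuf_sum (\<lambda>w. M (y # w)) (x # a) b"
  by (cases a; simp add: shuf_sum_def multiset.map_comp o_def)+

lemma shuf_sum_add: "shuf_sum (\<lambda>w. M w + N w) a b = shuf_sum M a b + shuf_sum N a b"
  by (simp add: shuf_sum_def sum_mset.distrib)

lemma shuf_sum_scale: "shuf_sum (\<lambda>w. c * M w) a b = c * shuf_sum M a b"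
  by (simp add: shuf_sum_def sum_mset_distrib_left)

text \<open>Compatibility of shuffling with deconcatenation: cutting a shuffle of \<open>a\<close>
  and \<open>b\<close> in two amounts to cutting \<open>a\<close> and \<open>b\<close> separately
  and shuffling the corresponding pieces.\<close>

lemma shuf_sum_mould_mult:
  "shuf_sum (M \<otimes>\<^sub>m N) a b =
     (\<Sum>i\<le>length a. \<Sum>j\<le>length b.
        shuf_sum M (take i a) (take j b) * shuf_sum N (drop i a) (drop j b))"
proof (induction a b arbitrary: M rule: shuf.induct)
  case (3 x a y b)
  show ?case
    by (simp add: mould_mult_Cons shuf_sum_add shuf_sum_scale 3 sum.atMost_Suc_shift
        sum.distrib algebra_simps del: sum.atMost_Suc)
qed (simp_all add: mould_mult_take_drop)

lemma length_shuf: "w \<in># shuf a b \<Longrightarrow> length w = length a + length b"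
  by (induction a b arbitrary: w rule: shuf.induct) auto

lemma word_sum_shuf: "w \<in># shuf a b \<Longrightarrow> word_sum \<phi> w = word_sum \<phi> a + word_sum \<phi> b"
  by (induction a b arbitrary: w rule: shuf.induct) (auto simp: word_sum_def)

lemma shuf_sum_cong: "(\<And>w. w \<in># shuf a b \<Longrightarrow> M w = N w) \<Longrightarrow> shuf_sum M a b = shuf_sum N a b"
  unfolding shuf_sum_def by (metis image_mset_cong)

lemma shuf_sum_nabla: "shuf_sum (nabla \<phi> M) a b = (word_sum \<phi> a + word_sum \<phi> b) * shuf_sum M a b"
  by (subst shuf_sum_scale [symmetric], rule shuf_sum_cong) (simp add: nabla_def word_sum_shuf)

lemma shuf_sum_mould_I:
  "shuf_sum mould_I a b =
     (if a = [] then mould_I b else if b = [] then mould_I a else 0)"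
proof (cases "a = [] \<or> b = []")
  case False
  have "shuf_sum mould_I a b = shuf_sum (\<lambda>w. 0) a b"
    using False by (intro shuf_sum_cong) (cases a; cases b; auto simp: mould_I_def dest!: length_shuf)
  then show ?thesis using False by (simp add: shuf_sum_def)
qed auto

text \<open>By multiplicativity and \<open>shuf_sum_mould_I\<close>, the right-hand pieces together
  must be a single letter: the last one of \<open>a\<close> or the last one of
  \<open>b\<close>.\<close>

lemma shuf_sum_mult_I:
  "shuf_sum (M \<otimes>\<^sub>m mould_I) a b =
     (if a = [] then 0 else shuf_sum M (butlast a) b) + (if b = [] then 0 else shuf_sum M a (butlast b))"
proof (cases "a = [] \<or> b = []")
  case True
  then show ?thesis by (auto simp: mould_mult_I)
next
  case False
  let ?m = "length a" and ?n = "length b"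
  have I: "shuf_sum (mould_I :: ('b, 'a) mould) (drop i a) (drop j b) =
      (if i = ?m - 1 \<and> j = ?n then 1 else 0) + (if i = ?m \<and> j = ?n - 1 then 1 else 0)"
    if "i \<le> ?m" "j \<le> ?n" for i j
    using that False by (cases a; cases b) (auto simp: shuf_sum_mould_I mould_I_def)
  have "shuf_sum (M \<otimes>\<^sub>m mould_I) a b =
     (\<Sum>i\<le>?m. \<Sum>j\<le>?n. shuf_sum M (take i a) (take j b) *
        ((if i = ?m - 1 \<and> j = ?n then 1 else 0) + (if i = ?m \<and> j = ?n - 1 then 1 else 0)))"
    unfolding shuf_sum_mould_mult by (intro sum.cong refl) (simp add: I)
  also have "\<dots> =
     (\<Sum>i\<le>?m. \<Sum>j\<le>?n. if j = ?n then if i = ?m - 1 then shuf_sum M (take i a) (take j b) else 0 else 0) +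
     (\<Sum>i\<le>?m. \<Sum>j\<le>?n. if j = ?n - 1 then if i = ?m then shuf_sum M (take i a) (take j b) else 0 else 0)"
    unfolding sum.distrib [symmetric] by (intro sum.cong refl) auto
  also have "\<dots> = shuf_sum M (butlast a) b + shuf_sum M a (butlast b)"
    by (simp add: butlast_conv_take)
  finally show ?thesis using False by simp
qed

section \<open>Agreement of \<open>shuf\<close> with the count of position sets in
  \<open>sh\<close>\<close>

lemma sh_Nil_right: "sh a b [] = (if a = [] \<and> b = [] then 1 else 0)"
  by (auto simp: sh_def)

text \<open>The summands count the position sets that contain \<open>0\<close> and those that do
  not.\<close>

lemma sh_Cons_right:
  "sh a b (z # w) =
     (if a \<noteq> [] \<and> hd a = z then sh (tl a) b w else 0) +
     (if b \<noteq> [] \<and> hd b = z then sh a (tl b) w else 0)"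
proof -
  define n where "n = length w"
  \<comment> \<open>\<open>f c Q\<close> is \<open>Q\<close> shifted by one, with position
    \<open>0\<close> added iff \<open>c\<close> holds. Every position set arises from exactly one
    pair \<open>c\<close>, \<open>Q\<close>.\<close>
  define f where "f c Q = (if c then {0} else {}) \<union> Suc ` Q" for c :: bool and Q :: "nat set"
  let ?X = "{P. P \<subseteq> {..<Suc n} \<and> nths (z # w) P = a \<and> nths (z # w) ({..<Suc n} - P) = b}"
  let ?A = "{Q. Q \<subseteq> {..<n} \<and> z # nths w Q = a \<and> nths w ({..<n} - Q) = b}"
  let ?B = "{Q. Q \<subseteq> {..<n} \<and> nths w Q = a \<and> z # nths w ({..<n} - Q) = b}"
  have f_eq: "f c Q = f c' Q' \<longleftrightarrow> c = c' \<and> Q = Q'" for c c' Q Q'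
    by (auto simp: f_def set_eq_iff image_iff split: if_splits)
  have inj: "inj_on (f c) S" for c S
    by (auto simp: f_eq inj_on_def)
  have f_le: "f c Q \<subseteq> {..<Suc n} \<longleftrightarrow> Q \<subseteq> {..<n}" for c Q
    by (auto simp: f_def)
  have f_nths: "nths (z # w) (f c Q) = (if c then [z] else []) @ nths w Q" for c Q
    by (auto simp: f_def nths_Cons image_iff)
  have "{j. Suc j \<in> {..<Suc n} - f c Q} = {..<n} - Q" for c Q
    by (auto simp: f_def)
  then have f_nths': "nths (z # w) ({..<Suc n} - f c Q) =
      (if c then [] else [z]) @ nths w ({..<n} - Q)" for c Q
    by (auto simp: nths_Cons) (auto simp: f_def)
  have f_surj: "\<exists>c Q. P = f c Q" for P
  proof (intro exI)
    have "x \<in> P \<longleftrightarrow> x \<in> f (0 \<in> P) {j. Suc j \<in> P}" for x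
      by (cases x) (auto simp: f_def)
    then show "P = f (0 \<in> P) {j. Suc j \<in> P}" by blast
  qed
  have f_mem: "f c Q \<in> ?X \<longleftrightarrow> f c Q \<in> f True ` ?A \<union> f False ` ?B" for c Q
  proof -
    have "f c Q \<in> f c' ` S \<longleftrightarrow> c = c' \<and> Q \<in> S" for c' S
      by (auto simp: f_eq)
    then show ?thesis
      by (cases c) (simp_all add: f_le f_nths f_nths')
  qed
  have "?X = f True ` ?A \<union> f False ` ?B"
  proof (rule set_eqI)
    fix P
    obtain c Q where "P = f c Q" using f_surj by blast
    then show "P \<in> ?X \<longleftrightarrow> P \<in> f True ` ?A \<union> f False ` ?B" by (simp only: f_mem)
  qed
  moreover have "f True ` ?A \<inter> f False ` ?B = {}"
    by (auto simp: f_eq)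
  moreover have "finite ?A" "finite ?B"
    by (rule finite_subset [of _ "Pow {..<n}"]; auto)+
  ultimately have "card ?X = card ?A + card ?B"
    by (simp add: card_Un_disjoint card_image inj)
  moreover have "card ?A = (if a \<noteq> [] \<and> hd a = z then sh (tl a) b w else 0)"
    by (cases a) (auto simp: sh_def n_def)
  moreover have "card ?B = (if b \<noteq> [] \<and> hd b = z then sh a (tl b) w else 0)"
    by (cases b) (auto simp: sh_def n_def)
  ultimately show ?thesis by (simp add: sh_def n_def)
qed

lemma count_image_Cons:
  "count (image_mset (Cons x) A) w = (if w \<noteq> [] \<and> hd w = x then count A (tl w) else 0)"
  by (cases w; induction A) auto

lemma count_shuf: "count (shuf a b) w = sh a b w"
proof (induction w arbitrary: a b)
  case Nil
  show ?case by (cases a; cases b) (auto simp: sh_Nil_right count_image_Cons)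
next
  case (Cons z w)
  show ?case
    by (cases a; cases b) (auto simp: sh_Cons_right count_image_Cons Cons.IH [symmetric])
qed

lemma sum_mset_eq_sum_count:
  assumes "finite S" "set_mset A \<subseteq> S"
  shows "(\<Sum>w\<in>#A. M w) = (\<Sum>w\<in>S. of_nat (count A w) * (M w :: 'a::comm_ring_1))"
  using assms(2)
proof (induction A)
  case (add x A)
  have "(\<Sum>w\<in>S. of_nat (count (add_mset x A) w) * M w) =
      (\<Sum>w\<in>S. (if w = x then M w else 0) + of_nat (count A w) * M w)"
    by (intro sum.cong) (auto simp: algebra_simps)
  then show ?case using add assms(1) by (simp add: sum.distrib)
qed simp

lemma sum_sh_eq_shuf_sum:
  "(\<Sum>w \<in> {w. sh a b w \<noteq> 0}. of_nat (sh a b w) * M w) = shuf_sum M a b"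
proof -
  have "{w. sh a b w \<noteq> 0} = set_mset (shuf a b)"
    by (auto simp flip: count_shuf simp: count_eq_zero_iff)
  then show ?thesis
    by (simp add: shuf_sum_def sum_mset_eq_sum_count [of "set_mset (shuf a b)"] count_shuf)
qed

text \<open>Once \<open>M [] = 1\<close>, pairs with an empty word satisfy the identity
  automatically.\<close>

lemma symmetral_iff_shuf_sum: "symmetral M \<longleftrightarrow> M [] = 1 \<and> (\<forall>a b. shuf_sum M a b = M a * M b)"
proof -
  have "shuf_sum M a b = M a * M b"
    if "M [] = 1" "a \<noteq> [] \<Longrightarrow> b \<noteq> [] \<Longrightarrow> shuf_sum M a b = M a * M b" for a b
    using that by (cases "a = []"; cases "b = []") auto
  then show ?thesis unfolding symmetral_def sum_sh_eq_shuf_sum by metis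
qed


section \<open>Laurent series without positive powers\<close>

text \<open>Two nonpositive exponents have a nonnegative sum only if both are zero.\<close>

lemma fls_mult_nth_nonneg:
  assumes "\<And>i. i > 0 \<Longrightarrow> f $$ i = 0" "\<And>i. i > 0 \<Longrightarrow> g $$ i = (0::'k::field)" "n \<ge> 0"
  shows "(f * g) $$ n = (if n = 0 then f $$ 0 * g $$ 0 else 0)"
proof -
  define d where "d = fls_subdegree g"
  have "(f * g) $$ n = (\<Sum>i = fls_subdegree f + d..n. f $$ (i - d) * g $$ (d + n - i))"
    unfolding d_def by (rule fls_times_nth)
  also have "\<dots> = (\<Sum>i = fls_subdegree f + d..n.
      if i = d then if n = 0 then f $$ 0 * g $$ 0 else 0 else 0)"
  proof (intro sum.cong refl)
    fix i
    consider "i < d" | "i > d" | "i = d" by linarith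
    then show "f $$ (i - d) * g $$ (d + n - i) =
        (if i = d then if n = 0 then f $$ 0 * g $$ 0 else 0 else 0)"
      using assms by cases auto
  qed
  also have "\<dots> = (if n = 0 \<and> fls_subdegree f + d \<le> d \<and> d \<le> 0 then f $$ 0 * g $$ 0 else 0)"
    by auto
  \<comment> \<open>If the summation range misses \<open>d\<close>, then \<open>0\<close> lies below
    one of the subdegrees, so the product of constant terms is zero anyway.\<close>
  also have "\<dots> = (if n = 0 then f $$ 0 * g $$ 0 else 0)"
    unfolding d_def by (auto intro!: fls_eq0_below_subdegree)
  finally show ?thesis .
qed

lemma K_minus_mult: "f \<in> K_minus \<Longrightarrow> g \<in> K_minus \<Longrightarrow> f * g \<in> K_minus"
  by (auto simp: K_minus_iff fls_mult_nth_nonneg)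

lemma K_minus_zero: "0 \<in> K_minus"
  and K_minus_add: "f \<in> K_minus \<Longrightarrow> g \<in> K_minus \<Longrightarrow> f + g \<in> K_minus"
  and K_minus_diff: "f \<in> K_minus \<Longrightarrow> g \<in> K_minus \<Longrightarrow> f - g \<in> K_minus"
  by (auto simp: K_minus_iff)

lemma K_plus_zero: "0 \<in> K_plus"
  and K_plus_add: "f \<in> K_plus \<Longrightarrow> g \<in> K_plus \<Longrightarrow> f + g \<in> K_plus"
  and K_plus_diff: "f \<in> K_plus \<Longrightarrow> g \<in> K_plus \<Longrightarrow> f - g \<in> K_plus"
  by (auto simp: K_plus_iff)

lemma K_plus_mult:
  assumes "f \<in> K_plus" "g \<in> K_plus"
  shows "f * g \<in> K_plus" "(f * g) $$ 0 = f $$ 0 * g $$ 0"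
proof -
  obtain p q where "f = fps_to_fls p" "g = fps_to_fls q"
    using assms by (auto simp: K_plus_def)
  then have *: "f * g = fps_to_fls (p * q)" "f = fps_to_fls p" "g = fps_to_fls q"
    by (simp_all add: fls_times_fps_to_fls)
  show "f * g \<in> K_plus" unfolding K_plus_def *(1) by blast
  show "(f * g) $$ 0 = f $$ 0 * g $$ 0"
    unfolding *(1) unfolding *(2,3) by (simp add: fps_to_fls_nth)
qed

lemma K_plus_sum: "(\<And>i. i \<in> I \<Longrightarrow> f i \<in> K_plus) \<Longrightarrow> sum f I \<in> K_plus"
  by (induction I rule: infinite_finite_induct) (auto intro: K_plus_zero K_plus_add)

lemma K_minus_K_plus_eq_0: "f \<in> K_minus \<Longrightarrow> f \<in> K_plus \<Longrightarrow> f = 0"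
  by (rule fls_eqI) (metis K_minus_iff K_plus_iff fls_zero_nth linorder_not_le)


section \<open>Birkhoff decomposition of a symmetral mould\<close>

lemma is_birkhoffD:
  assumes "is_birkhoff T (U_minus, U_plus)"
  shows "U_minus [] = 1" "U_plus [] = 1" "w \<noteq> [] \<Longrightarrow> U_minus w \<in> K_minus"
    "U_plus w \<in> K_plus" "U_minus \<otimes>\<^sub>m T = U_plus"
  using assms by (cases "w = []"; auto simp: is_birkhoff_def K_plus_iff)+

text \<open>Once \<open>V\<close> vanishes on shorter words, only \<open>V w * T [] = V w\<close>
  survives in the product, and it lies in both \<open>K_minus\<close> and
  \<open>K_plus\<close>.\<close>

lemma mould_K_minus_mult_in_K_plus_eq_0:
  assumes "T [] = 1" "\<And>w. V w \<in> K_minus" "\<And>w. (V \<otimes>\<^sub>m T) w \<in> K_plus"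
  shows "V w = 0"
proof (induction w rule: length_induct)
  case (1 w)
  have "(V \<otimes>\<^sub>m T) w = V w"
    using 1 assms(1) by (cases "w = []") (auto simp: mould_mult_Nil mould_mult_nonempty)
  then show ?case using assms K_minus_K_plus_eq_0 by metis
qed

lemma shuf_sum_mem:
  assumes "\<And>w. w \<in># shuf a b \<Longrightarrow> M w \<in> H" "0 \<in> H" "\<And>x y. x \<in> H \<Longrightarrow> y \<in> H \<Longrightarrow> x + y \<in> H"
  shows "shuf_sum M a b \<in> H"
proof -
  have "(\<Sum>w\<in>#A. M w) \<in> H" if "\<And>w. w \<in># A \<Longrightarrow> M w \<in> H" for A
    using that by (induction A) (auto intro: assms(2,3))
  then show ?thesis using assms(1) by (simp add: shuf_sum_def)
qed

text \<open>
  Both \<open>shuf_sum U_minus\<close> and the tensor square of \<open>U_minus\<close> are the negative part of a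
  Birkhoff decomposition of the tensor square of \<open>T\<close>, so they agree by uniqueness.
\<close>

lemma symmetral_birkhoff:
  assumes T: "symmetral T" and U: "is_birkhoff T (U_minus, U_plus)"
  shows "symmetral U_plus"
proof -
  from U have U1: "U_minus [] = 1" "U_plus [] = 1"
    and Um: "\<And>w. w \<noteq> [] \<Longrightarrow> U_minus w \<in> K_minus"
    and Up: "\<And>w. U_plus w \<in> K_plus"
    and UT: "U_minus \<otimes>\<^sub>m T = U_plus"
    by (auto dest: is_birkhoffD)
  from T have T1: "T [] = 1" and Tsh: "\<And>a b. shuf_sum T a b = T a * T b"
    by (auto simp: symmetral_iff_shuf_sum)
  \<comment> \<open>\<open>X\<close> and \<open>Y\<close> measure the failure of
    \<open>U_minus\<close> and \<open>U_plus\<close> to be symmetral.\<close>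
  define X where "X a b = shuf_sum U_minus a b - U_minus a * U_minus b" for a b
  define Y where "Y a b = shuf_sum U_plus a b - U_plus a * U_plus b" for a b
  have Y_eq: "Y a b = (\<Sum>i\<le>length a. \<Sum>j\<le>length b.
      X (take i a) (take j b) * (T (drop i a) * T (drop j b)))" for a b
  proof -
    have "shuf_sum U_plus a b = (\<Sum>i\<le>length a. \<Sum>j\<le>length b.
        shuf_sum U_minus (take i a) (take j b) * (T (drop i a) * T (drop j b)))"
      unfolding UT [symmetric] shuf_sum_mould_mult Tsh ..
    moreover have "U_plus a * U_plus b = (\<Sum>i\<le>length a. \<Sum>j\<le>length b.
        U_minus (take i a) * U_minus (take j b) * (T (drop i a) * T (drop j b)))"
      unfolding UT [symmetric] mould_mult_take_drop sum_product
      by (simp add: mult_ac)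
    ultimately show ?thesis
      by (simp add: Y_def X_def left_diff_distrib sum_subtractf)
  qed
  have X_minus: "X a b \<in> K_minus" for a b
  proof (cases "a = [] \<or> b = []")
    case True
    \<comment> \<open>Here \<open>U_minus [] = 1\<close> is outside \<open>K_minus\<close>, but the
      two terms of \<open>X\<close> cancel.\<close>
    then show ?thesis by (auto simp: X_def U1 K_minus_zero)
  next
    case False
    then have "shuf_sum U_minus a b \<in> K_minus"
      by (intro shuf_sum_mem K_minus_zero K_minus_add Um) (auto dest: length_shuf)
    then show ?thesis
      using False unfolding X_def by (intro K_minus_diff K_minus_mult Um) auto
  qed
  have Y_plus: "Y a b \<in> K_plus" for a b
    unfolding Y_def by (intro K_plus_diff K_plus_mult shuf_sum_mem K_plus_zero K_plus_add Up)
  have X0: "X a b = 0" for a b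
  proof (induction "length a + length b" arbitrary: a b rule: less_induct)
    case less
    \<comment> \<open>The induction hypothesis leaves only the cut at the end of both words.\<close>
    have "X (take i a) (take j b) * (T (drop i a) * T (drop j b)) =
        (if j = length b then if i = length a then X a b else 0 else 0)"
      if "i \<le> length a" "j \<le> length b" for i j
      using that less [of "take i a" "take j b"] T1 by auto
    then have "Y a b = (\<Sum>i\<le>length a. \<Sum>j\<le>length b.
        if j = length b then if i = length a then X a b else 0 else 0)"
      unfolding Y_eq by (intro sum.cong refl) simp
    then have "Y a b = X a b" by simp
    then show ?case using X_minus Y_plus K_minus_K_plus_eq_0 by metis
  qed
  have "Y a b = 0" for a b
    unfolding Y_eq X0 by simp
  then show ?thesis
    by (simp add: symmetral_iff_shuf_sum U1 Y_def)
qed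


section \<open>The mould \<open>T\<close>\<close>

text \<open>Each letter carries its own \<epsilon>, so the denominators of \<open>T_mould\<close>
  are the word sums of the nonempty prefixes.\<close>

definition deformed_phi :: "('n \<Rightarrow> 'k::field) \<Rightarrow> 'n \<Rightarrow> 'k fls" where
  "deformed_phi \<phi> n = fls_const (\<phi> n) + fls_X"

lemma word_sum_deformed:
  "word_sum (deformed_phi \<phi>) w = fls_const (word_sum \<phi> w) + of_nat (length w) * fls_X"
  by (induction w) (simp_all add: word_sum_def deformed_phi_def algebra_simps flip: fls_plus_const)

lemma word_sum_deformed_mult_nth:
  "(word_sum (deformed_phi \<phi>) w * f) $$ i =
     word_sum \<phi> w * f $$ i + of_nat (length w) * f $$ (i - 1)"
proof -
  have "word_sum (deformed_phi \<phi>) w * f =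
      fls_const (word_sum \<phi> w) * f + of_nat (length w) * (fls_X * f)"
    by (simp only: word_sum_deformed distrib_right mult.assoc)
  then show ?thesis by (simp add: fls_X_times_conv_shift)
qed

text \<open>The coefficient of \<epsilon> is the length of \<open>w\<close>, nonzero in
  characteristic \<open>0\<close>.\<close>

lemma word_sum_deformed_nonzero:
  assumes "w \<noteq> []"
  shows "word_sum (deformed_phi (\<phi> :: 'n \<Rightarrow> 'k::field_char_0)) w \<noteq> 0"
proof
  assume "word_sum (deformed_phi \<phi>) w = 0"
  then have "(word_sum (deformed_phi \<phi>) w * 1) $$ 1 = 0" by simp
  then show False using assms unfolding word_sum_deformed_mult_nth by simp
qed

lemma nabla_T_mould:
  fixes \<phi> :: "'n \<Rightarrow> 'k::field_char_0"
  shows "nabla (deformed_phi \<phi>) (T_mould \<phi>) = T_mould \<phi> \<otimes>\<^sub>m mould_I"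
proof
  fix w
  show "nabla (deformed_phi \<phi>) (T_mould \<phi>) w = (T_mould \<phi> \<otimes>\<^sub>m mould_I) w"
  proof (cases w rule: rev_cases)
    case Nil
    then show ?thesis by (simp add: nabla_def mould_mult_I word_sum_def)
  next
    case (snoc u x)
    have T: "T_mould \<phi> v = 1 / (\<Prod>i = 1..length v. word_sum (deformed_phi \<phi>) (take i v))" for v
      unfolding T_mould_def word_sum_deformed by (intro arg_cong2[where f = "(/)"] prod.cong) auto
    have "(\<Prod>i = 1..length w. word_sum (deformed_phi \<phi>) (take i w)) =
        (\<Prod>i = 1..length u. word_sum (deformed_phi \<phi>) (take i u)) * word_sum (deformed_phi \<phi>) w"
      using snoc by simp
    then show ?thesis
      using snoc word_sum_deformed_nonzero [of w \<phi>]
      unfolding nabla_def mould_mult_I T by simp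
  qed
qed

text \<open>Multiplied by \<open>word_sum ?\<psi> (a @ b)\<close>, both sides satisfy the same
  recursion, which removes a last letter from \<open>a\<close> or from \<open>b\<close>; this factor
  can be cancelled.\<close>

lemma symmetral_T_mould: "symmetral (T_mould (\<phi> :: 'n \<Rightarrow> 'k::field_char_0))"
proof -
  let ?\<psi> = "deformed_phi \<phi>" and ?T = "T_mould \<phi>"
  have "shuf_sum ?T a b = ?T a * ?T b" for a b
  proof (induction "length a + length b" arbitrary: a b rule: less_induct)
    case less
    show ?case
    proof (cases "a = [] \<or> b = []")
      case True
      then show ?thesis by (auto simp: T_mould_Nil)
    next
      case False
      have T: "word_sum ?\<psi> w * ?T w = ?T (butlast w)" if "w \<noteq> []" for w
        using fun_cong [OF nabla_T_mould [of \<phi>], of w] that by (simp add: nabla_def mould_mult_I)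
      have "(word_sum ?\<psi> a + word_sum ?\<psi> b) * shuf_sum ?T a b
          = shuf_sum ?T (butlast a) b + shuf_sum ?T a (butlast b)"
        unfolding shuf_sum_nabla [symmetric] nabla_T_mould shuf_sum_mult_I using False by simp
      also have "\<dots> = ?T (butlast a) * ?T b + ?T a * ?T (butlast b)"
        using False less [of "butlast a" b] less [of a "butlast b"] by simp
      also have "\<dots> = (word_sum ?\<psi> a + word_sum ?\<psi> b) * (?T a * ?T b)"
        using False by (simp add: algebra_simps flip: T)
      finally show ?thesis
        using False word_sum_deformed_nonzero [of "a @ b" \<phi>] by (simp add: word_sum_append)
    qed
  qed
  then show ?thesis by (simp add: symmetral_iff_shuf_sum T_mould_Nil)
qed


section \<open>The mould equation\<close>

theorem theorem2:
  fixes \<phi> :: "'n \<Rightarrow> 'k::field_char_0"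
    and U_minus U_plus :: "('n, 'k fls) mould"
    and R S :: "('n, 'k) mould"
  assumes "birkhoff (T_mould \<phi>) = (U_minus, U_plus)"
    and "\<And>w. R w = - of_nat (length w) * fls_residue (U_minus w)"
    and "\<And>w. S w = U_plus w $$ 0"
  shows "nabla \<phi> S = (\<lambda>w. (S \<otimes>\<^sub>m mould_I) w - (R \<otimes>\<^sub>m S) w) \<and>
         nabla \<phi> R = (\<lambda>w. 0) \<and>
         symmetral S"
proof -
  let ?\<psi> = "deformed_phi \<phi>" and ?T = "T_mould \<phi>"
  let ?R = "\<lambda>w. fls_const (R w)"
  have U: "is_birkhoff ?T (U_minus, U_plus)"
    using assms(1) birkhoff_eq_iff T_mould_Nil by metis
  then have U1: "U_minus [] = 1" "U_plus [] = 1"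
    and Um: "\<And>w. w \<noteq> [] \<Longrightarrow> U_minus w \<in> K_minus"
    and Up: "\<And>w. U_plus w \<in> K_plus"
    and UT: "U_minus \<otimes>\<^sub>m ?T = U_plus"
    by (auto dest: is_birkhoffD)
  have Um_nth: "U_minus w $$ i = (if w = [] \<and> i = 0 then 1 else 0)" if "i \<ge> 0" for w i
    using that Um [of w] U1 by (cases "w = []") (auto simp: K_minus_iff)
  define V where "V w = nabla ?\<psi> U_minus w + (?R \<otimes>\<^sub>m U_minus) w" for w
  have VT: "(V \<otimes>\<^sub>m ?T) w = nabla ?\<psi> U_plus w - (U_plus \<otimes>\<^sub>m mould_I) w + (?R \<otimes>\<^sub>m U_plus) w" for w
  proof -
    have "(U_plus \<otimes>\<^sub>m mould_I) w = (U_minus \<otimes>\<^sub>m nabla ?\<psi> ?T) w"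
      unfolding nabla_T_mould UT [symmetric] mould_mult_assoc ..
    moreover have "nabla ?\<psi> U_plus w = (nabla ?\<psi> U_minus \<otimes>\<^sub>m ?T) w + (U_minus \<otimes>\<^sub>m nabla ?\<psi> ?T) w"
      unfolding UT [symmetric] by (rule nabla_mould_mult)
    moreover have "(?R \<otimes>\<^sub>m U_plus) w = ((?R \<otimes>\<^sub>m U_minus) \<otimes>\<^sub>m ?T) w"
      unfolding UT [symmetric] mould_mult_assoc ..
    ultimately show ?thesis
      by (simp add: V_def [abs_def] mould_mult_add_left)
  qed
  have V_minus: "V w \<in> K_minus" for w
    unfolding K_minus_iff
  proof (intro allI impI)
    fix i :: int assume i: "i \<ge> 0"
    \<comment> \<open>At \<open>i = 0\<close> the factor \<epsilon> brings in the residue times the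
      length, which is \<open>- R w\<close>. For the empty word, word sum and length are both
      zero.\<close>
    have "nabla ?\<psi> U_minus w $$ i = (if i = 0 then - R w else 0)"
      unfolding nabla_def word_sum_deformed_mult_nth using i
      by (auto simp: Um_nth assms(2) word_sum_def)
    \<comment> \<open>Only \<open>U_minus [] = 1\<close> has a nonzero coefficient at a nonnegative
      exponent.\<close>
    moreover have "(?R \<otimes>\<^sub>m U_minus) w $$ i =
        (\<Sum>j\<le>length w. if j = length w then if i = 0 then R w else 0 else 0)"
      unfolding mould_mult_take_drop fls_nth_sum fls_mult_const_nth
      using i by (intro sum.cong) (auto simp: Um_nth)
    ultimately show "V w $$ i = 0" by (simp add: V_def)
  qed
  have VT_plus: "(V \<otimes>\<^sub>m ?T) w \<in> K_plus" for w
    unfolding VT unfolding nabla_def word_sum_deformed mould_mult_take_drop mould_I_def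
    by (intro K_plus_add K_plus_diff K_plus_mult K_plus_sum Up) (auto simp: K_plus_iff fls_of_nat_nth)
  have V0: "V w = 0" for w
    using T_mould_Nil V_minus VT_plus by (rule mould_K_minus_mult_in_K_plus_eq_0)

  have "nabla \<phi> S w = (S \<otimes>\<^sub>m mould_I) w - (R \<otimes>\<^sub>m S) w" for w
  proof -
    have "nabla ?\<psi> U_plus w = (U_plus \<otimes>\<^sub>m mould_I) w - (?R \<otimes>\<^sub>m U_plus) w"
      using VT [of w] by (simp add: V0 mould_mult_take_drop algebra_simps)
    then have "nabla ?\<psi> U_plus w $$ 0 = (U_plus \<otimes>\<^sub>m mould_I) w $$ 0 - (?R \<otimes>\<^sub>m U_plus) w $$ 0"
      by simp
    \<comment> \<open>The contribution of \<epsilon> involves the residue of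
      \<open>U_plus w\<close>, which is zero.\<close>
    moreover have "nabla ?\<psi> U_plus w $$ 0 = nabla \<phi> S w"
      unfolding nabla_def word_sum_deformed_mult_nth using Up [of w] by (simp add: assms(3) K_plus_iff)
    moreover have "(U_plus \<otimes>\<^sub>m mould_I) w $$ 0 = (S \<otimes>\<^sub>m mould_I) w"
      by (simp add: mould_mult_I assms(3))
    moreover have "(?R \<otimes>\<^sub>m U_plus) w $$ 0 = (R \<otimes>\<^sub>m S) w"
      by (simp add: mould_mult_take_drop fls_nth_sum assms(3))
    ultimately show ?thesis by simp
  qed
  moreover have "nabla \<phi> R w = 0" for w
  proof -
    have "U_minus w = 0" if "word_sum \<phi> w \<noteq> 0"
      using that
    proof (induction w rule: length_induct)
      case (1 w)
      then have w: "w \<noteq> []" by (auto simp: word_sum_def)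
      \<comment> \<open>As \<open>word_sum \<phi> w \<noteq> 0\<close>, one of the two pieces has
        nonzero word sum. The induction hypothesis applies to it, and \<open>R\<close> vanishes
        where \<open>U_minus\<close> does; for \<open>i = 0\<close> the length factor makes
        \<open>R []\<close> zero.\<close>
      have "R (take i w) = 0 \<or> U_minus (drop i w) = 0" if "i < length w" for i
      proof (cases "i = 0 \<or> word_sum \<phi> (take i w) \<noteq> 0")
        case True
        then show ?thesis using 1 that by (auto simp: assms(2))
      next
        case False
        then have "word_sum \<phi> (drop i w) \<noteq> 0"
          using 1 word_sum_append [of \<phi> "take i w" "drop i w"] by simp
        moreover have "length (drop i w) < length w" using False that by auto
        ultimately show ?thesis using "1.IH" by blast
      qed
      then have "?R (take i w) * U_minus (drop i w) = (if i = length w then ?R w else 0)"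
        if "i \<le> length w" for i
        using that by (cases "i = length w") (fastforce simp: U1)+
      then have "(?R \<otimes>\<^sub>m U_minus) w = (\<Sum>i\<le>length w. if i = length w then ?R w else 0)"
        unfolding mould_mult_take_drop by (intro sum.cong refl) simp
      then have eq: "word_sum ?\<psi> w * U_minus w = - ?R w"
        using V0 [of w] unfolding V_def nabla_def by (simp add: eq_neg_iff_add_eq_0)
      show ?case
      proof (rule ccontr)
        define d where "d = fls_subdegree (U_minus w)"
        assume "U_minus w \<noteq> 0"
        then have nz: "U_minus w $$ d \<noteq> 0"
          by (simp add: d_def)
        then have "d < 0"
          using Um_nth [of d w] w by (cases "d < 0") auto
        \<comment> \<open>The product is a constant series, and \<open>d\<close> is negative. On the
          left only \<open>\<phi>\<close> contributes at exponent \<open>d\<close>, since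
          \<open>d - 1\<close> is below the subdegree.\<close>
        then have "(word_sum ?\<psi> w * U_minus w) $$ d = 0"
          unfolding eq by simp
        then have "word_sum \<phi> w * U_minus w $$ d = 0"
          unfolding word_sum_deformed_mult_nth by (simp add: d_def)
        then show False using nz "1.prems" by simp
      qed
    qed
    then show ?thesis by (auto simp: nabla_def assms(2))
  qed
  moreover have "symmetral S"
  proof -
    have sym: "symmetral U_plus"
      using symmetral_T_mould U by (rule symmetral_birkhoff)
    have "shuf_sum S a b = S a * S b" for a b
    proof -
      \<comment> \<open>Taking constant terms is additive, and multiplicative on
        \<open>K_plus\<close>, so symmetrality descends from \<open>U_plus\<close> to
        \<open>S\<close>.\<close>
      have nth: "(\<Sum>w\<in>#A. U_plus w) $$ 0 = (\<Sum>w\<in>#A. S w)" for A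
        by (induction A) (simp_all add: assms(3))
      have "shuf_sum S a b = shuf_sum U_plus a b $$ 0"
        by (simp add: shuf_sum_def nth)
      also have "\<dots> = (U_plus a * U_plus b) $$ 0"
        using sym by (simp add: symmetral_iff_shuf_sum)
      finally show ?thesis by (simp add: K_plus_mult Up assms(3))
    qed
    then show ?thesis by (simp add: symmetral_iff_shuf_sum U1 assms(3))
  qed
  ultimately show ?thesis by (intro conjI ext)
qed

end
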